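(* Let $\Theta=\{(a,\kappa,\gamma)\in\mathbb C^3:\operatorname{Re}(a)>0\}$, and for $\xi,\eta\in\Theta$ let $Q_1$ and $Q_2$ be polynomials in $x\in\mathbb R$ with parameter dependent coefficients, $$Q_1(\xi,\eta,x)=\sum_{i=0}^m\alpha_i(\xi,\eta)x^i,\qquad Q_2(\xi,\eta,x)=\sum_{j=0}^n\beta_j(\xi,\eta)x^j .$$ Assume that $\overline{\alpha_i(\xi,\eta)}=\alpha_i(\bar\xi,\bar\eta)$ for all $i=0,\dots,m$. Then the Gaussian weighted inner product and its $\sigma$-gradient, $\sigma\in\{\xi,\eta\}$, are given by $$\big\langle Q_1(\xi,\eta,\cdot)g(\xi,\cdot),\,Q_2(\xi,\eta,\cdot)g(\eta,\cdot)\big\rangle=\sum_{s=0}^{n+m}c_s(\xi,\eta)\,G_s(\bar\xi+\eta),$$ $$\nabla_\sigma\big\langle Q_1(\xi,\eta,\cdot)g(\xi,\cdot),\,Q_2(\xi,\eta,\cdot)g(\eta,\cdot)\big\rangle=\sum_{s=0}^{n+m}\Big(\nabla_\sigma c_s(\xi,\eta)\,G_s(\bar\xi+\eta)+\delta_{\sigma\eta}\,c_s(\xi,\eta)\,\nabla_\eta G_s(\bar\xi+\eta)\Big),$$ where $$c_s(\xi,\eta)=\sum_{\substack{0\le i\le m,\;0\le j\le n\\ i+j=s}}\alpha_i(\bar\xi,\bar\eta)\,\beta_j(\xi,\eta),\qquad \nabla_\eta c_s(\xi,\eta)=\sum_{\substack{0\le i\le m,\;0\le j\le n\\ i+j=s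}}\alpha_i(\bar\xi,\bar\eta)\,\nabla_\eta\beta_j(\xi,\eta).$$
   Context: For $\theta=(a,\kappa,\gamma)\in\Theta$: $g(\theta,x)=e^{-ax^2+\kappa x+\gamma}$, $x\in\mathbb R$, and $G_s(\theta)=\int_{\mathbb R}x^s g(\theta,x)\,dx$ for $s=0,1,2,\dots$. The inner product is that of $L^2(\mathbb R,\mathbb C)$, antilinear in the first argument: $\langle v,w\rangle=\int_{\mathbb R}\overline{v(x)}\,w(x)\,dx$. Bars denote componentwise complex conjugation. $\nabla_\xi,\nabla_\eta$ denote the gradients with respect to the complex parameters $\xi,\eta$, in which the conjugated parameters $\bar\xi,\bar\eta$ are treated as constants. $\delta_{\sigma\eta}$ equals $1$ if $\sigma$ is the variable $\eta$ and $0$ if $\sigma$ is the variable $\xi$.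
   Formalization: For the gradient formulas it is additionally assumed that, on Θ, each α_i is complex differentiable and each β_j real differentiable in the variable σ; without holomorphy of α_i the formula for ∇_η c_s fails, e.g. for α_0 equal to the conjugate of κ_η and β_0 = 1. *)

theory Defs
  imports "HOL-Analysis.Analysis"
begin

text \<open>A parameter \<open>\<theta> = (a, \<kappa>, \<gamma>)\<close> is a vector in \<open>complex ^ 3\<close> with
  \<open>a = \<theta> $ 1\<close>, \<open>\<kappa> = \<theta> $ 2\<close>, \<open>\<gamma> = \<theta> $ 3\<close>.\<close>

definition Theta :: "(complex ^ 3) set" where
  "Theta = {\<theta>. Re (\<theta> $ 1) > 0}"

definition conj_param :: "complex ^ 3 \<Rightarrow> complex ^ 3" where
  "conj_param \<theta> = (\<chi> k. cnj (\<theta> $ k))"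

definition gauss :: "complex ^ 3 \<Rightarrow> real \<Rightarrow> complex" where
  "gauss \<theta> x = exp (- (\<theta> $ 1) * (complex_of_real x)\<^sup>2 + \<theta> $ 2 * complex_of_real x + \<theta> $ 3)"

definition gauss_moment :: "nat \<Rightarrow> complex ^ 3 \<Rightarrow> complex" where
  "gauss_moment s \<theta> = (\<integral>x. complex_of_real x ^ s * gauss \<theta> x \<partial>lborel)"

definition L2_inner :: "(real \<Rightarrow> complex) \<Rightarrow> (real \<Rightarrow> complex) \<Rightarrow> complex" where
  "L2_inner v w = (\<integral>x. cnj (v x) * w x \<partial>lborel)"

definition param_poly ::
  "nat \<Rightarrow> (nat \<Rightarrow> complex ^ 3 \<Rightarrow> complex ^ 3 \<Rightarrow> complex) \<Rightarrow> complex ^ 3 \<Rightarrow> complex ^ 3 \<Rightarrow> real \<Rightarrow> complex"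
where
  "param_poly d \<alpha> \<xi> \<eta> x = (\<Sum>i=0..d. \<alpha> i \<xi> \<eta> * complex_of_real x ^ i)"

definition gauss_inner ::
  "nat \<Rightarrow> (nat \<Rightarrow> complex ^ 3 \<Rightarrow> complex ^ 3 \<Rightarrow> complex) \<Rightarrow>
   nat \<Rightarrow> (nat \<Rightarrow> complex ^ 3 \<Rightarrow> complex ^ 3 \<Rightarrow> complex) \<Rightarrow> complex ^ 3 \<Rightarrow> complex ^ 3 \<Rightarrow> complex"
where
  "gauss_inner m \<alpha> n \<beta> \<xi> \<eta> =
     L2_inner (\<lambda>x. param_poly m \<alpha> \<xi> \<eta> x * gauss \<xi> x) (\<lambda>x. param_poly n \<beta> \<xi> \<eta> x * gauss \<eta> x)"

definition prod_coeff ::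
  "nat \<Rightarrow> (nat \<Rightarrow> complex ^ 3 \<Rightarrow> complex ^ 3 \<Rightarrow> complex) \<Rightarrow>
   nat \<Rightarrow> (nat \<Rightarrow> complex ^ 3 \<Rightarrow> complex ^ 3 \<Rightarrow> complex) \<Rightarrow> nat \<Rightarrow> complex ^ 3 \<Rightarrow> complex ^ 3 \<Rightarrow> complex"
where
  "prod_coeff m \<alpha> n \<beta> s \<xi> \<eta> =
     (\<Sum>(i, j) \<in> {(i, j). i \<le> m \<and> j \<le> n \<and> i + j = s}.
        \<alpha> i (conj_param \<xi>) (conj_param \<eta>) * \<beta> j \<xi> \<eta>)"

text \<open>The gradient in which conjugated parameters count as constants is the Wirtinger gradient
  \<open>(\<partial>f/\<partial>z\<^sub>k)\<^sub>k\<close> with \<open>\<partial>/\<partial>z = (\<partial>/\<partial>Re z - \<i> \<partial>/\<partial>Im z) / 2\<close>. It is meaningful for real-differentiable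
  \<open>f\<close>; for holomorphic \<open>f\<close> it is the vector of complex partial derivatives.\<close>

definition wirtinger_grad :: "(complex ^ 3 \<Rightarrow> complex) \<Rightarrow> complex ^ 3 \<Rightarrow> complex ^ 3" where
  "wirtinger_grad f \<theta> =
     (let D = frechet_derivative f (at \<theta>)
      in \<chi> k. (D (axis k 1) - \<i> * D (axis k \<i>)) / 2)"

definition complex_differentiable :: "(complex ^ 3 \<Rightarrow> complex) \<Rightarrow> complex ^ 3 \<Rightarrow> bool" where
  "complex_differentiable f \<theta> \<longleftrightarrow>
     (\<exists>D. (f has_derivative D) (at \<theta>) \<and> (\<forall>c v. D (c *s v) = c * D v))"

datatype param_var = Xi | Eta

fun slice ::
  "param_var \<Rightarrow> (complex ^ 3 \<Rightarrow> complex ^ 3 \<Rightarrow> complex) \<Rightarrow>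
   complex ^ 3 \<Rightarrow> complex ^ 3 \<Rightarrow> complex ^ 3 \<Rightarrow> complex"
where
  "slice Xi F \<xi> \<eta> = (\<lambda>\<xi>'. F \<xi>' \<eta>)"
| "slice Eta F \<xi> \<eta> = (\<lambda>\<eta>'. F \<xi> \<eta>')"

fun point :: "param_var \<Rightarrow> complex ^ 3 \<Rightarrow> complex ^ 3 \<Rightarrow> complex ^ 3" where
  "point Xi \<xi> \<eta> = \<xi>"
| "point Eta \<xi> \<eta> = \<eta>"

definition grad ::
  "param_var \<Rightarrow> (complex ^ 3 \<Rightarrow> complex ^ 3 \<Rightarrow> complex) \<Rightarrow> complex ^ 3 \<Rightarrow> complex ^ 3 \<Rightarrow> complex ^ 3"
where
  "grad \<sigma> F \<xi> \<eta> = wirtinger_grad (slice \<sigma> F \<xi> \<eta>) (point \<sigma> \<xi> \<eta>)"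

definition differentiable_in ::
  "param_var \<Rightarrow> (complex ^ 3 \<Rightarrow> complex ^ 3 \<Rightarrow> complex) \<Rightarrow> complex ^ 3 \<Rightarrow> complex ^ 3 \<Rightarrow> bool"
where
  "differentiable_in \<sigma> F \<xi> \<eta> \<longleftrightarrow> slice \<sigma> F \<xi> \<eta> differentiable (at (point \<sigma> \<xi> \<eta>))"

definition complex_differentiable_in ::
  "param_var \<Rightarrow> (complex ^ 3 \<Rightarrow> complex ^ 3 \<Rightarrow> complex) \<Rightarrow> complex ^ 3 \<Rightarrow> complex ^ 3 \<Rightarrow> bool"
where
  "complex_differentiable_in \<sigma> F \<xi> \<eta> \<longleftrightarrow> complex_differentiable (slice \<sigma> F \<xi> \<eta>) (point \<sigma> \<xi> \<eta>)"

text \<open>The gradient formulas treat \<open>\<alpha> i (conj_param \<xi>) (conj_param \<eta>)\<close> as a constant, which is correct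
  for the Wirtinger gradient exactly when \<open>\<alpha> i\<close> is holomorphic. For \<open>\<beta> j\<close>, real differentiability
  suffices.\<close>

definition regular_coeffs ::
  "param_var \<Rightarrow> nat \<Rightarrow> (nat \<Rightarrow> complex ^ 3 \<Rightarrow> complex ^ 3 \<Rightarrow> complex) \<Rightarrow>
   nat \<Rightarrow> (nat \<Rightarrow> complex ^ 3 \<Rightarrow> complex ^ 3 \<Rightarrow> complex) \<Rightarrow> bool"
where
  "regular_coeffs \<sigma> m \<alpha> n \<beta> \<longleftrightarrow>
     (\<forall>\<xi>\<in>Theta. \<forall>\<eta>\<in>Theta.
        (\<forall>i\<le>m. complex_differentiable_in \<sigma> (\<alpha> i) \<xi> \<eta>) \<and>
        (\<forall>j\<le>n. differentiable_in \<sigma> (\<beta> j) \<xi> \<eta>))"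

end

theory Submission
  imports Defs "HOL-Probability.Distributions"
begin

text \<open>
  Since \<open>x\<close> is real, \<open>cnj (gauss \<xi> x) * gauss \<eta> x\<close> is again a Gaussian, with parameter
  \<open>conj_param \<xi> + \<eta>\<close>, which stays in \<open>Theta\<close>. Multiplying out the two polynomials, collecting
  equal powers of \<open>x\<close> and integrating termwise gives the moment formula
  (\<open>gauss_inner_eq_moments\<close>).

  The gradient formula is then the product rule applied to \<open>c\<^sub>s * G\<^sub>s\<close>, together with the fact that the
  Wirtinger gradient annihilates the conjugate of a holomorphic function (\<open>has_grad_cnj\<close>). That
  fact is used twice. On \<open>Theta\<close> the symmetry hypothesis turns
  \<open>\<alpha>\<^sub>i (conj_param \<xi>) (conj_param \<eta>)\<close> into \<open>cnj (\<alpha>\<^sub>i \<xi> \<eta>)\<close>, so this factor of \<open>c\<^sub>s\<close> acts as a constant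
  (\<open>has_grad_prod_coeff\<close>). Likewise, as a function of \<open>\<xi>\<close>, the moment at \<open>conj_param \<xi> + \<eta>\<close> is the
  conjugate of the moment at \<open>\<xi> + conj_param \<eta>\<close>, so only the \<open>\<eta>\<close>-gradient sees the moments
  (\<open>has_grad_shifted_moment\<close>).

  The analytic input is that the moments are holomorphic on \<open>Theta\<close>. Their derivative is found by
  integrating the Gaussian against the increment of its exponent, and the remainder is bounded by
  a Gaussian integral times the square of the increment (\<open>gauss_moment_has_derivative\<close>).
\<close>

section \<open>Convergence of Gaussian moments\<close>

text \<open>This is an absolute moment of the normal distribution with variance \<open>1 / (2 * c)\<close>.\<close>

lemma integrable_abs_power_gaussian:
  assumes "c > 0"
  shows "integrable lborel (\<lambda>x::real. \<bar>x\<bar> ^ k * exp (- (c * x\<^sup>2)))"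
proof -
  define \<sigma> where "\<sigma> = 1 / sqrt (2 * c)"
  have \<sigma>: "\<sigma> > 0" "\<sigma>\<^sup>2 = 1 / (2 * c)"
    using assms by (auto simp: \<sigma>_def power_divide)
  have "integrable lborel (\<lambda>x. sqrt (2 * pi * \<sigma>\<^sup>2) * (normal_density 0 \<sigma> x * \<bar>x - 0\<bar> ^ k))"
    by (intro integrable_mult_right integrable_normal_moment_abs \<sigma>)
  moreover have "sqrt (2 * pi * \<sigma>\<^sup>2) * (normal_density 0 \<sigma> x * \<bar>x - 0\<bar> ^ k)
      = \<bar>x\<bar> ^ k * exp (- (c * x\<^sup>2))" for x
    using assms by (simp add: normal_density_def \<sigma> mult_ac)
  ultimately show ?thesis by (simp only:)
qed

text \<open>Completing the square absorbs the linear term of the exponent at the price of half of the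
  quadratic decay.\<close>

lemma norm_gauss_bound:
  assumes "\<theta> \<in> Theta"
  obtains K where "\<And>x. norm (gauss \<theta> x) \<le> exp (K - Re (\<theta> $ 1) / 2 * x\<^sup>2)"
proof
  define c b where "c = Re (\<theta> $ 1)" and "b = Re (\<theta> $ 2)"
  have c: "c > 0" using assms by (simp add: Theta_def c_def)
  fix x :: real
  have "0 \<le> (c * x - b)\<^sup>2 / (2 * c)" using c by simp
  also have "\<dots> = c / 2 * x\<^sup>2 - b * x + b\<^sup>2 / (2 * c)"
    using c by (simp add: field_simps power2_eq_square)
  finally have *: "- (c * x\<^sup>2) + b * x \<le> b\<^sup>2 / (2 * c) - c / 2 * x\<^sup>2"
    by (simp add: field_simps)
  have "norm (gauss \<theta> x) = exp (- (c * x\<^sup>2) + b * x + Re (\<theta> $ 3))"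
    by (simp add: gauss_def c_def b_def flip: of_real_power)
  then show "norm (gauss \<theta> x)
      \<le> exp ((Re (\<theta> $ 2))\<^sup>2 / (2 * Re (\<theta> $ 1)) + Re (\<theta> $ 3) - Re (\<theta> $ 1) / 2 * x\<^sup>2)"
    using * by (simp add: c_def b_def)
qed

lemma gauss_measurable [measurable]: "gauss \<theta> \<in> borel_measurable borel"
  unfolding gauss_def by measurable

lemma integrable_gauss_moment:
  assumes "\<theta> \<in> Theta"
  shows "integrable lborel (\<lambda>x. complex_of_real x ^ s * gauss \<theta> x)"
proof -
  define c where "c = Re (\<theta> $ 1) / 2"
  have c: "c > 0" using assms by (simp add: Theta_def c_def)
  obtain K where K: "\<And>x. norm (gauss \<theta> x) \<le> exp (K - c * x\<^sup>2)"
    using norm_gauss_bound[OF assms] unfolding c_def by metis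
  have "integrable lborel (\<lambda>x. exp K * (\<bar>x\<bar> ^ s * exp (- (c * x\<^sup>2))))"
    by (intro integrable_mult_right integrable_abs_power_gaussian c)
  then show ?thesis
  proof (rule Bochner_Integration.integrable_bound, goal_cases)
    case 2
    have "norm (complex_of_real x ^ s * gauss \<theta> x)
        \<le> norm (exp K * (\<bar>x\<bar> ^ s * exp (- (c * x\<^sup>2))))" for x
    proof -
      have "norm (complex_of_real x ^ s * gauss \<theta> x) \<le> \<bar>x\<bar> ^ s * exp (K - c * x\<^sup>2)"
        using K by (simp add: norm_mult norm_power mult_left_mono)
      then show ?thesis by (simp add: exp_diff exp_minus field_simps abs_mult)
    qed
    then show ?case by simp
  qed measurable
qed

section \<open>Holomorphy of Gaussian moments\<close>

lemma has_derivative_quadratic_remainder: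
  fixes f :: "'a::real_normed_vector \<Rightarrow> 'b::real_normed_vector"
  assumes "bounded_linear D" "\<delta> > 0"
    and "\<And>h. norm h < \<delta> \<Longrightarrow> norm (f (x + h) - f x - D h) \<le> B * (norm h)\<^sup>2"
  shows "(f has_derivative D) (at x)"
  unfolding has_derivative_at_alt
proof (intro conjI allI impI)
  fix e :: real assume "e > 0"
  define d where "d = min \<delta> (e / (\<bar>B\<bar> + 1))"
  have "norm (f y - f x - D (y - x)) \<le> e * norm (y - x)" if "norm (y - x) < d" for y
  proof -
    have "norm (f y - f x - D (y - x)) \<le> B * (norm (y - x))\<^sup>2"
      using assms(3)[of "y - x"] that by (simp add: d_def)
    also have "\<dots> = (B * norm (y - x)) * norm (y - x)"
      by (simp add: power2_eq_square)
    also have "\<dots> \<le> e * norm (y - x)"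
    proof (rule mult_right_mono)
      have "B * norm (y - x) \<le> (\<bar>B\<bar> + 1) * norm (y - x)"
        by (intro mult_right_mono) auto
      also have "\<dots> \<le> e"
        using that by (simp add: d_def field_simps)
      finally show "B * norm (y - x) \<le> e" .
    qed simp
    finally show ?thesis .
  qed
  moreover have "d > 0" using \<open>e > 0\<close> \<open>\<delta> > 0\<close> by (simp add: d_def)
  ultimately show "\<exists>d>0. \<forall>y. norm (y - x) < d \<longrightarrow> norm (f y - f x - D (y - x)) \<le> e * norm (y - x)"
    by blast
qed (fact assms(1))

lemma norm_exp_remainder: "norm (exp p - 1 - p :: complex) \<le> exp (norm p) * (norm p)\<^sup>2"
proof -
  have "norm (exp p - (\<Sum>i\<le>1. p ^ i / fact i)) \<le> exp (norm p) * norm p ^ Suc 1 / fact 1"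
    by (rule Taylor_exp_field)
  then show ?thesis by (simp add: diff_diff_eq numeral_2_eq_2)
qed

definition exponent :: "complex ^ 3 \<Rightarrow> real \<Rightarrow> complex" where
  "exponent \<theta> x = - (\<theta> $ 1) * (complex_of_real x)\<^sup>2 + \<theta> $ 2 * complex_of_real x + \<theta> $ 3"

lemma gauss_add: "gauss (\<theta> + h) x = gauss \<theta> x * exp (exponent h x)"
  by (simp add: gauss_def exponent_def algebra_simps flip: exp_add)

lemma norm_exponent_le: "norm (exponent h x) \<le> 2 * norm h * (1 + x\<^sup>2)"
proof -
  have "norm (exponent h x) \<le> norm (h $ 1) * x\<^sup>2 + norm (h $ 2) * \<bar>x\<bar> + norm (h $ 3)"
    unfolding exponent_def
    by (rule order.trans[OF norm_triangle_ineq] add_mono order_refl)+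
       (simp_all add: norm_mult norm_power)
  also have "\<dots> \<le> norm h * x\<^sup>2 + norm h * \<bar>x\<bar> + norm h"
    by (intro add_mono mult_right_mono Finite_Cartesian_Product.norm_nth_le) auto
  also have "\<dots> = norm h * (x\<^sup>2 + \<bar>x\<bar> + 1)" by (simp add: algebra_simps)
  also have "\<dots> \<le> norm h * (2 * (1 + x\<^sup>2))"
  proof (rule mult_left_mono)
    have "0 \<le> (\<bar>x\<bar> - 1)\<^sup>2 + x\<^sup>2 + 1" by simp
    then show "x\<^sup>2 + \<bar>x\<bar> + 1 \<le> 2 * (1 + x\<^sup>2)" by (simp add: power2_diff)
  qed simp
  finally show ?thesis by (simp add: mult_ac)
qed

text \<open>
  A perturbation \<open>h\<close> of the parameter multiplies the Gaussian by \<open>exp p\<close> with \<open>p = exponent h x\<close>, which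
  is linear in \<open>h\<close>. Integrating \<open>p\<close> gives the derivative; the remainder \<open>exp p - 1 - p\<close> is at most
  \<open>exp (norm p) * (norm p)\<^sup>2\<close>, where \<open>norm p \<le> 2 * norm h * (1 + x\<^sup>2)\<close>. For small \<open>h\<close> the
  growth of \<open>exp (norm p)\<close> costs only part of the Gaussian decay, so an integrable function times \<open>(norm h)\<^sup>2\<close> dominates.
\<close>

lemma gauss_moment_has_derivative:
  assumes "\<theta> \<in> Theta"
  shows "(gauss_moment s has_derivative
           (\<lambda>h. - (h $ 1) * gauss_moment (s + 2) \<theta> + h $ 2 * gauss_moment (s + 1) \<theta>
                + h $ 3 * gauss_moment s \<theta>)) (at \<theta>)" (is "(_ has_derivative ?D) _")
proof -
  define c where "c = Re (\<theta> $ 1) / 2"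
  have c: "c > 0" using assms by (simp add: Theta_def c_def)
  obtain K where K: "\<And>x. norm (gauss \<theta> x) \<le> exp (K - c * x\<^sup>2)"
    using norm_gauss_bound[OF assms] unfolding c_def by metis
  \<comment> \<open>The decay \<open>c\<close> loses \<open>c / 2\<close> to \<open>exp (norm p)\<close> when \<open>norm h < c / 4\<close>; the constant \<open>exp (c / 2)\<close> comes
    from the same factor.\<close>
  define M where "M x = 4 * exp (K + c / 2) * (\<bar>x\<bar> ^ s * (1 + x\<^sup>2)\<^sup>2 * exp (- (c / 2 * x\<^sup>2)))" for x
  have "M = (\<lambda>x. 4 * exp (K + c / 2) * (\<bar>x\<bar> ^ s * exp (- (c / 2 * x\<^sup>2))
      + 2 * (\<bar>x\<bar> ^ (s + 2) * exp (- (c / 2 * x\<^sup>2))) + \<bar>x\<bar> ^ (s + 4) * exp (- (c / 2 * x\<^sup>2))))"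
  proof
    fix x :: real
    have "\<bar>x\<bar> ^ s * (1 + x\<^sup>2)\<^sup>2 = \<bar>x\<bar> ^ s * (1 + \<bar>x\<bar>\<^sup>2)\<^sup>2" by simp
    also have "\<dots> = \<bar>x\<bar> ^ s + 2 * \<bar>x\<bar> ^ (s + 2) + \<bar>x\<bar> ^ (s + 4)"
      by (simp only: power2_sum, simp add: algebra_simps power_add flip: power_mult)
         (simp add: power2_eq_square)
    finally show "M x = 4 * exp (K + c / 2) * (\<bar>x\<bar> ^ s * exp (- (c / 2 * x\<^sup>2))
      + 2 * (\<bar>x\<bar> ^ (s + 2) * exp (- (c / 2 * x\<^sup>2))) + \<bar>x\<bar> ^ (s + 4) * exp (- (c / 2 * x\<^sup>2)))"
      unfolding M_def by (simp only:) (simp add: algebra_simps)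
  qed
  then have M_int: "integrable lborel M"
    using c by (simp only:) (intro integrable_mult_right Bochner_Integration.integrable_add
        integrable_abs_power_gaussian; simp)
  have M_nonneg: "M x \<ge> 0" for x
    by (simp add: M_def)
  have bound: "norm (complex_of_real x ^ s * gauss \<theta> x * (exp (exponent h x) - 1 - exponent h x))
      \<le> M x * (norm h)\<^sup>2" if h: "norm h < c / 4" for h x
  proof -
    have p: "norm (exponent h x) \<le> c / 2 * (1 + x\<^sup>2)"
      by (rule order.trans[OF norm_exponent_le], rule mult_right_mono) (use h in auto)
    have "norm (exp (exponent h x) - 1 - exponent h x)
        \<le> exp (norm (exponent h x)) * (norm (exponent h x))\<^sup>2"
      by (rule norm_exp_remainder)
    also have "\<dots> \<le> exp (c / 2 * (1 + x\<^sup>2)) * (2 * norm h * (1 + x\<^sup>2))\<^sup>2"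
      using p by (intro mult_mono power_mono norm_exponent_le) auto
    finally have r: "norm (exp (exponent h x) - 1 - exponent h x)
        \<le> exp (c / 2 * (1 + x\<^sup>2)) * (2 * norm h * (1 + x\<^sup>2))\<^sup>2" .
    have "norm (complex_of_real x ^ s * gauss \<theta> x * (exp (exponent h x) - 1 - exponent h x))
        \<le> \<bar>x\<bar> ^ s * exp (K - c * x\<^sup>2) * (exp (c / 2 * (1 + x\<^sup>2)) * (2 * norm h * (1 + x\<^sup>2))\<^sup>2)"
      unfolding norm_mult using K r by (intro mult_mono) (auto simp: norm_power)
    also have "\<dots> = 4 * (exp (K - c * x\<^sup>2) * exp (c / 2 * (1 + x\<^sup>2)))
        * (\<bar>x\<bar> ^ s * (1 + x\<^sup>2)\<^sup>2) * (norm h)\<^sup>2"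
      by (simp only: power_mult_distrib) simp
    also have "exp (K - c * x\<^sup>2) * exp (c / 2 * (1 + x\<^sup>2)) = exp (K + c / 2) * exp (- (c / 2 * x\<^sup>2))"
      by (simp add: field_simps flip: exp_add)
    finally show ?thesis by (simp add: M_def mult_ac)
  qed
  have int: "integrable lborel (\<lambda>x. complex_of_real x ^ k * gauss \<theta> x)" for k
    by (rule integrable_gauss_moment[OF assms])
  have remainder: "norm (gauss_moment s (\<theta> + h) - gauss_moment s \<theta> - ?D h)
      \<le> integral\<^sup>L lborel M * (norm h)\<^sup>2" if h: "norm h < c / 4" for h
  proof -
    have "\<bar>Re (h $ 1)\<bar> < c / 4"
      using h Finite_Cartesian_Product.norm_nth_le[of h 1] abs_Re_le_cmod[of "h $ 1"] by linarith
    then have "\<theta> + h \<in> Theta"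
      using c by (simp add: Theta_def c_def)
    then have int_h: "integrable lborel (\<lambda>x. complex_of_real x ^ s * gauss (\<theta> + h) x)"
      by (rule integrable_gauss_moment)
    have "gauss_moment s (\<theta> + h) - gauss_moment s \<theta> - ?D h
        = (\<integral>x. complex_of_real x ^ s * gauss (\<theta> + h) x - complex_of_real x ^ s * gauss \<theta> x
             - (- (h $ 1) * (complex_of_real x ^ (s + 2) * gauss \<theta> x)
                + h $ 2 * (complex_of_real x ^ (s + 1) * gauss \<theta> x)
                + h $ 3 * (complex_of_real x ^ s * gauss \<theta> x)) \<partial>lborel)"
      unfolding gauss_moment_def
      by (simp only: Bochner_Integration.integral_diff Bochner_Integration.integral_add
          integral_mult_right_zero Bochner_Integration.integrable_diff
          Bochner_Integration.integrable_add integrable_mult_right int int_h)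
    also have "\<dots> = (\<integral>x. complex_of_real x ^ s * gauss \<theta> x
                     * (exp (exponent h x) - 1 - exponent h x) \<partial>lborel)"
      by (rule Bochner_Integration.integral_cong)
         (simp_all add: gauss_add exponent_def algebra_simps power2_eq_square)
    also have "norm \<dots> \<le> (\<integral>x. M x * (norm h)\<^sup>2 \<partial>lborel)"
      using bound[OF h] M_int
      by (intro order.trans[OF integral_norm_bound] integral_mono')
         (auto simp: M_nonneg)
    finally show ?thesis by simp
  qed
  have D: "bounded_linear ?D"
    by (intro bounded_linear_add bounded_linear_mult_const bounded_linear_minus
        bounded_linear_vec_nth)
  show ?thesis
  proof (rule has_derivative_quadratic_remainder[OF D])
    show "c / 4 > 0" using c by simp
  qed (fact remainder)
qed

lemma complex_differentiable_gauss_moment: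
  assumes "\<theta> \<in> Theta"
  shows "complex_differentiable (gauss_moment s) \<theta>"
  unfolding complex_differentiable_def
  by (rule exI conjI gauss_moment_has_derivative[OF assms])+ (simp add: algebra_simps)

lemma complex_differentiable_translate:
  assumes "complex_differentiable f (w + z)"
  shows "complex_differentiable (\<lambda>z. f (w + z)) z"
proof -
  obtain D where D: "(f has_derivative D) (at (w + z))" "\<And>c v. D (c *s v) = c * D v"
    using assms by (auto simp: complex_differentiable_def)
  have "((\<lambda>z. w + z) has_derivative (\<lambda>v. v)) (at z)"
    by (auto intro!: derivative_eq_intros)
  from diff_chain_at[OF this D(1)] show ?thesis
    using D(2) by (auto simp: complex_differentiable_def o_def)
qed

lemma Theta_add: "\<xi> \<in> Theta \<Longrightarrow> \<eta> \<in> Theta \<Longrightarrow> \<xi> + \<eta> \<in> Theta"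
  by (simp add: Theta_def)

lemma conj_param_in_Theta: "\<xi> \<in> Theta \<Longrightarrow> conj_param \<xi> \<in> Theta"
  by (simp add: Theta_def conj_param_def)

lemma open_Theta: "open Theta"
  unfolding Theta_def by (intro open_Collect_less continuous_intros)

lemma conj_param_add: "conj_param (\<xi> + \<eta>) = conj_param \<xi> + conj_param \<eta>"
  by (simp add: conj_param_def vec_eq_iff)

lemma conj_param_conj_param [simp]: "conj_param (conj_param \<xi>) = \<xi>"
  by (simp add: conj_param_def vec_eq_iff)

lemma cnj_gauss: "cnj (gauss \<theta> x) = gauss (conj_param \<theta>) x"
  by (simp add: gauss_def conj_param_def exp_cnj)

lemma gauss_mult: "gauss \<xi> x * gauss \<eta> x = gauss (\<xi> + \<eta>) x"
  by (simp add: gauss_def algebra_simps flip: exp_add)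

lemma cnj_gauss_moment: "cnj (gauss_moment s \<theta>) = gauss_moment s (conj_param \<theta>)"
  unfolding gauss_moment_def by (subst Bochner_Integration.integral_cnj[symmetric]) (simp add: cnj_gauss)

section \<open>Wirtinger gradients of parametrised functions\<close>

text \<open>Gradient and differentiability are bundled into one relation so that the calculus rules
  compose: the sum and product rules for \<open>grad\<close> have real differentiability as a
  side condition.\<close>

definition has_grad ::
  "param_var \<Rightarrow> (complex ^ 3 \<Rightarrow> complex ^ 3 \<Rightarrow> complex) \<Rightarrow> complex ^ 3 \<Rightarrow>
   complex ^ 3 \<Rightarrow> complex ^ 3 \<Rightarrow> bool"
where
  "has_grad \<sigma> F G \<xi> \<eta> \<longleftrightarrow>
     (\<exists>D. (slice \<sigma> F \<xi> \<eta> has_derivative D) (at (point \<sigma> \<xi> \<eta>)) \<and>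
          G = (\<chi> k. (D (axis k 1) - \<i> * D (axis k \<i>)) / 2))"

lemma has_grad_imp:
  assumes "has_grad \<sigma> F G \<xi> \<eta>"
  shows "differentiable_in \<sigma> F \<xi> \<eta>" "grad \<sigma> F \<xi> \<eta> = G"
proof -
  obtain D where D: "(slice \<sigma> F \<xi> \<eta> has_derivative D) (at (point \<sigma> \<xi> \<eta>))"
    "G = (\<chi> k. (D (axis k 1) - \<i> * D (axis k \<i>)) / 2)"
    using assms by (auto simp: has_grad_def)
  show "differentiable_in \<sigma> F \<xi> \<eta>"
    using D(1) by (auto simp: differentiable_in_def differentiable_def)
  show "grad \<sigma> F \<xi> \<eta> = G"
    using frechet_derivative_at[OF D(1)] D(2) by (simp add: grad_def wirtinger_grad_def Let_def)
qed

lemma has_grad_grad: "differentiable_in \<sigma> F \<xi> \<eta> \<Longrightarrow> has_grad \<sigma> F (grad \<sigma> F \<xi> \<eta>) \<xi> \<eta>"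
  by (auto simp: differentiable_in_def has_grad_def grad_def wirtinger_grad_def Let_def
      frechet_derivative_works)

lemma slice_point [simp]: "slice \<sigma> F \<xi> \<eta> (point \<sigma> \<xi> \<eta>) = F \<xi> \<eta>"
  by (cases \<sigma>) auto

lemma has_grad_mult:
  assumes "has_grad \<sigma> F F' \<xi> \<eta>" "has_grad \<sigma> H H' \<xi> \<eta>"
  shows "has_grad \<sigma> (\<lambda>\<xi> \<eta>. F \<xi> \<eta> * H \<xi> \<eta>) (F \<xi> \<eta> *s H' + H \<xi> \<eta> *s F') \<xi> \<eta>"
proof -
  obtain D E where D: "(slice \<sigma> F \<xi> \<eta> has_derivative D) (at (point \<sigma> \<xi> \<eta>))"
      "F' = (\<chi> k. (D (axis k 1) - \<i> * D (axis k \<i>)) / 2)"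
    and E: "(slice \<sigma> H \<xi> \<eta> has_derivative E) (at (point \<sigma> \<xi> \<eta>))"
      "H' = (\<chi> k. (E (axis k 1) - \<i> * E (axis k \<i>)) / 2)"
    using assms by (auto simp: has_grad_def)
  have "slice \<sigma> (\<lambda>\<xi> \<eta>. F \<xi> \<eta> * H \<xi> \<eta>) \<xi> \<eta> = (\<lambda>z. slice \<sigma> F \<xi> \<eta> z * slice \<sigma> H \<xi> \<eta> z)"
    by (cases \<sigma>) auto
  then show ?thesis
    unfolding has_grad_def
    by (intro exI[of _ "\<lambda>h. F \<xi> \<eta> * E h + D h * H \<xi> \<eta>"])
       (use has_derivative_mult[OF D(1) E(1)] in \<open>simp add: D(2) E(2) vec_eq_iff field_simps\<close>)
qed

lemma has_grad_sum:
  assumes "\<And>i. i \<in> I \<Longrightarrow> has_grad \<sigma> (F i) (F' i) \<xi> \<eta>"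
  shows "has_grad \<sigma> (\<lambda>\<xi> \<eta>. \<Sum>i\<in>I. F i \<xi> \<eta>) (\<Sum>i\<in>I. F' i) \<xi> \<eta>"
proof -
  have "\<forall>i\<in>I. \<exists>D. (slice \<sigma> (F i) \<xi> \<eta> has_derivative D) (at (point \<sigma> \<xi> \<eta>)) \<and>
      F' i = (\<chi> k. (D (axis k 1) - \<i> * D (axis k \<i>)) / 2)"
    using assms unfolding has_grad_def by blast
  from bchoice[OF this] obtain D
    where D: "\<And>i. i \<in> I \<Longrightarrow> (slice \<sigma> (F i) \<xi> \<eta> has_derivative D i) (at (point \<sigma> \<xi> \<eta>))"
      "\<And>i. i \<in> I \<Longrightarrow> F' i = (\<chi> k. (D i (axis k 1) - \<i> * D i (axis k \<i>)) / 2)"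
    by blast
  have "slice \<sigma> (\<lambda>\<xi> \<eta>. \<Sum>i\<in>I. F i \<xi> \<eta>) \<xi> \<eta> = (\<lambda>z. \<Sum>i\<in>I. slice \<sigma> (F i) \<xi> \<eta> z)"
    by (cases \<sigma>) auto
  then show ?thesis
    unfolding has_grad_def
    by (intro exI[of _ "\<lambda>h. \<Sum>i\<in>I. D i h"])
       (use has_derivative_sum[of I "\<lambda>i. slice \<sigma> (F i) \<xi> \<eta>" D, OF D(1)] in
         \<open>simp add: D(2) vec_eq_iff sum_distrib_left flip: sum_subtractf sum_divide_distrib\<close>)
qed

text \<open>The identities to be differentiated hold only on \<open>Theta\<close>, which suffices because \<open>Theta\<close> is
  open.\<close>

lemma has_grad_cong:
  assumes "has_grad \<sigma> F G \<xi> \<eta>" "\<xi> \<in> Theta" "\<eta> \<in> Theta"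
    and eq: "\<And>\<xi> \<eta>. \<xi> \<in> Theta \<Longrightarrow> \<eta> \<in> Theta \<Longrightarrow> F \<xi> \<eta> = H \<xi> \<eta>"
  shows "has_grad \<sigma> H G \<xi> \<eta>"
proof -
  obtain D where D: "(slice \<sigma> F \<xi> \<eta> has_derivative D) (at (point \<sigma> \<xi> \<eta>))"
    "G = (\<chi> k. (D (axis k 1) - \<i> * D (axis k \<i>)) / 2)"
    using assms(1) by (auto simp: has_grad_def)
  have p: "point \<sigma> \<xi> \<eta> \<in> Theta" using assms(2,3) by (cases \<sigma>) auto
  have "slice \<sigma> F \<xi> \<eta> z = slice \<sigma> H \<xi> \<eta> z" if "z \<in> Theta" for z
    using that assms(2,3) eq by (cases \<sigma>) auto
  from has_derivative_transform_within_open[OF D(1) open_Theta p this] D(2)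
  show ?thesis unfolding has_grad_def by blast
qed

text \<open>The derivative \<open>E = cnj \<circ> D\<close> is conjugate linear, so \<open>E (axis k \<i>) = - \<i> * E (axis k 1)\<close> and the two
  terms of the Wirtinger derivative cancel.\<close>

lemma has_grad_cnj:
  assumes "complex_differentiable_in \<sigma> F \<xi> \<eta>"
  shows "has_grad \<sigma> (\<lambda>\<xi> \<eta>. cnj (F \<xi> \<eta>)) 0 \<xi> \<eta>"
proof -
  obtain D where D: "(slice \<sigma> F \<xi> \<eta> has_derivative D) (at (point \<sigma> \<xi> \<eta>))"
    "\<And>c v. D (c *s v) = c * D v"
    using assms by (auto simp: complex_differentiable_in_def complex_differentiable_def)
  have eq: "slice \<sigma> (\<lambda>\<xi> \<eta>. cnj (F \<xi> \<eta>)) \<xi> \<eta> = (\<lambda>z. cnj (slice \<sigma> F \<xi> \<eta> z))"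
    by (cases \<sigma>) auto
  have "D (axis k \<i>) = \<i> * D (axis k 1)" for k
  proof -
    have "axis k \<i> = \<i> *s axis k 1" by (simp add: vec_eq_iff axis_def)
    then show ?thesis by (simp add: D(2))
  qed
  then have "(0 :: complex ^ 3) = (\<chi> k. (cnj (D (axis k 1)) - \<i> * cnj (D (axis k \<i>))) / 2)"
    by (simp add: vec_eq_iff)
  then show ?thesis
    using has_derivative_cnj[OF D(1)] unfolding has_grad_def eq by blast
qed

section \<open>The inner product and its gradient\<close>

text \<open>By the symmetry hypothesis \<open>\<alpha> i (conj_param \<xi>) (conj_param \<eta>)\<close> is the conjugate of a function that is
  holomorphic in the selected variable, so the product rule leaves only the gradient of \<open>\<beta> j\<close>.\<close>

lemma has_grad_prod_coeff:
  assumes conj_\<alpha>: "\<And>i \<xi> \<eta>. i \<le> m \<Longrightarrow> \<xi> \<in> Theta \<Longrightarrow> \<eta> \<in> Theta \<Longrightarrow>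
      cnj (\<alpha> i \<xi> \<eta>) = \<alpha> i (conj_param \<xi>) (conj_param \<eta>)"
    and reg: "regular_coeffs \<sigma> m \<alpha> n \<beta>" and \<xi>: "\<xi> \<in> Theta" and \<eta>: "\<eta> \<in> Theta"
  shows "has_grad \<sigma> (prod_coeff m \<alpha> n \<beta> s)
    (\<Sum>(i, j) \<in> {(i, j). i \<le> m \<and> j \<le> n \<and> i + j = s}.
       \<alpha> i (conj_param \<xi>) (conj_param \<eta>) *s grad \<sigma> (\<beta> j) \<xi> \<eta>) \<xi> \<eta>"
proof -
  let ?I = "{(i, j). i \<le> m \<and> j \<le> n \<and> i + j = s}"
  have "has_grad \<sigma> (\<lambda>\<xi> \<eta>. cnj (\<alpha> i \<xi> \<eta>) * \<beta> j \<xi> \<eta>)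
      (\<alpha> i (conj_param \<xi>) (conj_param \<eta>) *s grad \<sigma> (\<beta> j) \<xi> \<eta>) \<xi> \<eta>"
    if "i \<le> m" "j \<le> n" for i j
  proof -
    have "complex_differentiable_in \<sigma> (\<alpha> i) \<xi> \<eta>" "differentiable_in \<sigma> (\<beta> j) \<xi> \<eta>"
      using reg \<xi> \<eta> that by (auto simp: regular_coeffs_def)
    from has_grad_mult[OF has_grad_cnj[OF this(1)] has_grad_grad[OF this(2)]]
    show ?thesis using that \<xi> \<eta> by (simp add: conj_\<alpha>)
  qed
  then have "has_grad \<sigma> (\<lambda>\<xi> \<eta>. \<Sum>p\<in>?I. cnj (\<alpha> (fst p) \<xi> \<eta>) * \<beta> (snd p) \<xi> \<eta>)
      (\<Sum>p\<in>?I. \<alpha> (fst p) (conj_param \<xi>) (conj_param \<eta>) *s grad \<sigma> (\<beta> (snd p)) \<xi> \<eta>) \<xi> \<eta>"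
    by (intro has_grad_sum) auto
  then have "has_grad \<sigma> (prod_coeff m \<alpha> n \<beta> s)
      (\<Sum>p\<in>?I. \<alpha> (fst p) (conj_param \<xi>) (conj_param \<eta>) *s grad \<sigma> (\<beta> (snd p)) \<xi> \<eta>) \<xi> \<eta>"
    by (rule has_grad_cong[OF _ \<xi> \<eta>])
       (auto simp: prod_coeff_def case_prod_beta conj_\<alpha> intro!: sum.cong)
  then show ?thesis by (simp add: case_prod_beta)
qed

text \<open>In \<open>\<eta>\<close> this is a translate of a holomorphic function; in \<open>\<xi>\<close> it is the conjugate of one,
  because conjugating a moment conjugates its parameter.\<close>

lemma has_grad_shifted_moment:
  assumes \<xi>: "\<xi> \<in> Theta" and \<eta>: "\<eta> \<in> Theta"
  shows "has_grad \<sigma> (\<lambda>\<xi> \<eta>. gauss_moment s (conj_param \<xi> + \<eta>))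
    ((if \<sigma> = Eta then 1 else 0) *s
      grad Eta (\<lambda>\<xi> \<eta>. gauss_moment s (conj_param \<xi> + \<eta>)) \<xi> \<eta>) \<xi> \<eta>"
proof (cases \<sigma>)
  case Xi
  have "complex_differentiable (\<lambda>\<xi>. gauss_moment s (conj_param \<eta> + \<xi>)) \<xi>"
    by (intro complex_differentiable_translate complex_differentiable_gauss_moment
        Theta_add conj_param_in_Theta assms)
  then have "complex_differentiable_in Xi (\<lambda>\<xi> \<eta>. gauss_moment s (conj_param \<eta> + \<xi>)) \<xi> \<eta>"
    by (simp add: complex_differentiable_in_def)
  from has_grad_cnj[OF this]
  have "has_grad Xi (\<lambda>\<xi> \<eta>. gauss_moment s (conj_param \<xi> + \<eta>)) 0 \<xi> \<eta>"
    by (simp add: cnj_gauss_moment conj_param_add add.commute)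
  then show ?thesis using Xi by simp
next
  case Eta
  have "complex_differentiable (\<lambda>\<eta>. gauss_moment s (conj_param \<xi> + \<eta>)) \<eta>"
    by (intro complex_differentiable_translate complex_differentiable_gauss_moment
        Theta_add conj_param_in_Theta assms)
  then have "differentiable_in Eta (\<lambda>\<xi> \<eta>. gauss_moment s (conj_param \<xi> + \<eta>)) \<xi> \<eta>"
    by (auto simp: differentiable_in_def complex_differentiable_def differentiable_def)
  from has_grad_grad[OF this] show ?thesis using Eta by simp
qed

lemma gauss_inner_eq_moments:
  assumes conj_\<alpha>: "\<And>i. i \<le> m \<Longrightarrow> cnj (\<alpha> i \<xi> \<eta>) = \<alpha> i (conj_param \<xi>) (conj_param \<eta>)"
    and \<xi>: "\<xi> \<in> Theta" and \<eta>: "\<eta> \<in> Theta"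
  shows "gauss_inner m \<alpha> n \<beta> \<xi> \<eta> =
    (\<Sum>s=0..n+m. prod_coeff m \<alpha> n \<beta> s \<xi> \<eta> * gauss_moment s (conj_param \<xi> + \<eta>))"
proof -
  let ?\<theta> = "conj_param \<xi> + \<eta>"
  let ?S = "{0..m} \<times> {0..n}"
  have \<theta>: "?\<theta> \<in> Theta" by (intro Theta_add conj_param_in_Theta \<xi> \<eta>)
  have pointwise: "cnj (param_poly m \<alpha> \<xi> \<eta> x * gauss \<xi> x) * (param_poly n \<beta> \<xi> \<eta> x * gauss \<eta> x)
      = (\<Sum>s=0..n+m. prod_coeff m \<alpha> n \<beta> s \<xi> \<eta> * (complex_of_real x ^ s * gauss ?\<theta> x))" for x
  proof -
    define h where "h p = \<alpha> (fst p) (conj_param \<xi>) (conj_param \<eta>) * \<beta> (snd p) \<xi> \<eta>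
      * (complex_of_real x ^ (fst p + snd p) * gauss ?\<theta> x)" for p
    have "cnj (param_poly m \<alpha> \<xi> \<eta> x * gauss \<xi> x) * (param_poly n \<beta> \<xi> \<eta> x * gauss \<eta> x)
        = cnj (param_poly m \<alpha> \<xi> \<eta> x) * param_poly n \<beta> \<xi> \<eta> x * gauss ?\<theta> x"
      by (simp add: cnj_gauss mult_ac flip: gauss_mult)
    also have "cnj (param_poly m \<alpha> \<xi> \<eta> x)
        = (\<Sum>i=0..m. \<alpha> i (conj_param \<xi>) (conj_param \<eta>) * complex_of_real x ^ i)"
      unfolding param_poly_def by (simp add: conj_\<alpha>)
    also have "\<dots> * param_poly n \<beta> \<xi> \<eta> x * gauss ?\<theta> x = sum h ?S"
      unfolding param_poly_def sum_product sum.cartesian_product unfolding sum_distrib_right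
      by (rule sum.cong) (auto simp: h_def power_add mult_ac)
    also have "\<dots> = (\<Sum>s=0..n+m. sum h {p \<in> ?S. fst p + snd p = s})"
      by (rule sum.group[symmetric]) auto
    also have "\<dots> = (\<Sum>s=0..n+m. prod_coeff m \<alpha> n \<beta> s \<xi> \<eta>
        * (complex_of_real x ^ s * gauss ?\<theta> x))"
      unfolding prod_coeff_def sum_distrib_right
      by (intro sum.cong refl) (auto simp: h_def)
    finally show ?thesis .
  qed
  show ?thesis
    unfolding gauss_inner_def L2_inner_def pointwise gauss_moment_def
    by (simp add: integrable_gauss_moment[OF \<theta>])
qed

theorem mainTheorem5:
  fixes m n :: nat
    and \<alpha> \<beta> :: "nat \<Rightarrow> complex ^ 3 \<Rightarrow> complex ^ 3 \<Rightarrow> complex"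
  assumes conj_\<alpha>: "\<And>i \<xi> \<eta>. i \<le> m \<Longrightarrow> \<xi> \<in> Theta \<Longrightarrow> \<eta> \<in> Theta \<Longrightarrow>
      cnj (\<alpha> i \<xi> \<eta>) = \<alpha> i (conj_param \<xi>) (conj_param \<eta>)"
  shows
    "(\<forall>\<xi>\<in>Theta. \<forall>\<eta>\<in>Theta.
        gauss_inner m \<alpha> n \<beta> \<xi> \<eta> =
        (\<Sum>s=0..n+m. prod_coeff m \<alpha> n \<beta> s \<xi> \<eta> * gauss_moment s (conj_param \<xi> + \<eta>))) \<and>
     (\<forall>\<sigma>. regular_coeffs \<sigma> m \<alpha> n \<beta> \<longrightarrow>
        (\<forall>\<xi>\<in>Theta. \<forall>\<eta>\<in>Theta.
           differentiable_in \<sigma> (gauss_inner m \<alpha> n \<beta>) \<xi> \<eta> \<and>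
           grad \<sigma> (gauss_inner m \<alpha> n \<beta>) \<xi> \<eta> =
           (\<Sum>s=0..n+m.
              gauss_moment s (conj_param \<xi> + \<eta>) *s grad \<sigma> (prod_coeff m \<alpha> n \<beta> s) \<xi> \<eta> +
              ((if \<sigma> = Eta then 1 else 0) * prod_coeff m \<alpha> n \<beta> s \<xi> \<eta>) *s
                grad Eta (\<lambda>\<xi>' \<eta>'. gauss_moment s (conj_param \<xi>' + \<eta>')) \<xi> \<eta>))) \<and>
     (regular_coeffs Eta m \<alpha> n \<beta> \<longrightarrow>
        (\<forall>\<xi>\<in>Theta. \<forall>\<eta>\<in>Theta. \<forall>s\<le>n+m.
           grad Eta (prod_coeff m \<alpha> n \<beta> s) \<xi> \<eta> =
           (\<Sum>(i, j) \<in> {(i, j). i \<le> m \<and> j \<le> n \<and> i + j = s}.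
              \<alpha> i (conj_param \<xi>) (conj_param \<eta>) *s grad Eta (\<beta> j) \<xi> \<eta>)))"
proof (intro conjI ballI allI impI)
  fix \<xi> \<eta> :: "complex ^ 3" assume \<xi>: "\<xi> \<in> Theta" and \<eta>: "\<eta> \<in> Theta"
  show "gauss_inner m \<alpha> n \<beta> \<xi> \<eta> =
      (\<Sum>s=0..n+m. prod_coeff m \<alpha> n \<beta> s \<xi> \<eta> * gauss_moment s (conj_param \<xi> + \<eta>))"
    by (intro gauss_inner_eq_moments conj_\<alpha> \<xi> \<eta>)
next
  fix \<sigma> and \<xi> \<eta> :: "complex ^ 3"
  assume reg: "regular_coeffs \<sigma> m \<alpha> n \<beta>" and \<xi>: "\<xi> \<in> Theta" and \<eta>: "\<eta> \<in> Theta"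
  let ?M = "\<lambda>s \<xi> \<eta>. gauss_moment s (conj_param \<xi> + \<eta>)"
  let ?c = "prod_coeff m \<alpha> n \<beta>"
  let ?G = "\<Sum>s=0..n+m. ?M s \<xi> \<eta> *s grad \<sigma> (?c s) \<xi> \<eta> +
      ((if \<sigma> = Eta then 1 else 0) * ?c s \<xi> \<eta>) *s grad Eta (?M s) \<xi> \<eta>"
  have "has_grad \<sigma> (?c s) (grad \<sigma> (?c s) \<xi> \<eta>) \<xi> \<eta>" for s
    by (rule has_grad_grad[OF has_grad_imp(1)], rule has_grad_prod_coeff[OF conj_\<alpha> reg \<xi> \<eta>])
  from has_grad_mult[OF this has_grad_shifted_moment[OF \<xi> \<eta>]]
  have "has_grad \<sigma> (\<lambda>\<xi> \<eta>. ?c s \<xi> \<eta> * ?M s \<xi> \<eta>)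
      (?M s \<xi> \<eta> *s grad \<sigma> (?c s) \<xi> \<eta> +
       ((if \<sigma> = Eta then 1 else 0) * ?c s \<xi> \<eta>) *s grad Eta (?M s) \<xi> \<eta>) \<xi> \<eta>" for s
    by (simp add: add.commute mult.commute vector_smult_assoc)
  then have "has_grad \<sigma> (\<lambda>\<xi> \<eta>. \<Sum>s=0..n+m. ?c s \<xi> \<eta> * ?M s \<xi> \<eta>) ?G \<xi> \<eta>"
    by (rule has_grad_sum)
  then have *: "has_grad \<sigma> (gauss_inner m \<alpha> n \<beta>) ?G \<xi> \<eta>"
    by (rule has_grad_cong[OF _ \<xi> \<eta>]) (rule gauss_inner_eq_moments[symmetric], rule conj_\<alpha>)
  show "differentiable_in \<sigma> (gauss_inner m \<alpha> n \<beta>) \<xi> \<eta>" by (rule has_grad_imp(1)[OF *])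
  show "grad \<sigma> (gauss_inner m \<alpha> n \<beta>) \<xi> \<eta> = ?G" by (rule has_grad_imp(2)[OF *])
next
  fix \<xi> \<eta> :: "complex ^ 3" and s
  assume "regular_coeffs Eta m \<alpha> n \<beta>" "\<xi> \<in> Theta" "\<eta> \<in> Theta"
  then show "grad Eta (prod_coeff m \<alpha> n \<beta> s) \<xi> \<eta> =
      (\<Sum>(i, j) \<in> {(i, j). i \<le> m \<and> j \<le> n \<and> i + j = s}.
         \<alpha> i (conj_param \<xi>) (conj_param \<eta>) *s grad Eta (\<beta> j) \<xi> \<eta>)"
    by (intro has_grad_imp(2) has_grad_prod_coeff conj_\<alpha>)
qed

end
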